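(* Let $d,p,m\ge 1$. Let $\boldsymbol\rho_1,\dots,\boldsymbol\rho_m$ be pure states on $\mathbb{C}^d$, let $y_1,\dots,y_m\in\{\pm1\}$, and let $\mathbf{M}_0$ be a $d\times d$ Hermitian matrix all of whose eigenvalues lie in $\{\pm1\}$. Let $\mathbf{U}(\boldsymbol\theta)$, $\boldsymbol\theta\in\mathbb{R}^p$, be any $p$-parameter ansatz $$\mathbf{U}(\boldsymbol\theta)=\mathbf{U}_p e^{-i\theta_p\mathbf{H}^{(p)}}\mathbf{U}_{p-1}e^{-i\theta_{p-1}\mathbf{H}^{(p-1)}}\cdots \mathbf{U}_1e^{-i\theta_1\mathbf{H}^{(1)}}\mathbf{U}_0$$ with unitaries $\mathbf{U}_0,\dots,\mathbf{U}_p$ and non-zero traceless Hermitian generators $\mathbf{H}^{(1)},\dots,\mathbf{H}^{(p)}$. Set $\mathbf{M}(\boldsymbol\theta)=\mathbf{U}(\boldsymbol\theta)^\dagger\mathbf{M}_0\mathbf{U}(\boldsymbol\theta)$ and $$L(\boldsymbol\theta)=\frac1{2m}\sum_{j=1}^m\big(\operatorname{tr}(\boldsymbol\rho_j\mathbf{M}(\boldsymbol\theta))-y_j\big)^2 .$$ Let $\boldsymbol\theta(t)$, $t\ge0$, follow the gradient flow $\frac{d\boldsymbol\theta}{dt}=-\eta\nabla L(\boldsymbol\theta(t))$ with learning rate $\eta>0$, started at a point with $L(\boldsymbol\theta(0))>0$. Then $L$ converges to zero at most at a sublinear rate; concretely, for all $t\ge0$, $$L(\boldsymbol\theta(t))\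 \ge\ \frac{1}{(c_0+c_1t)^2},\qquad c_0=\frac{1}{\sqrt{L(\boldsymbol\theta(0))}},\qquad c_1=12\,\eta\sum_{l=1}^p\|\mathbf{H}^{(l)}\|_{\mathrm{op}}^2 .$$
   Context: A quantum state on $\mathbb{C}^d$ is a positive semidefinite $d\times d$ Hermitian matrix of trace $1$; it is pure if it has rank one, i.e. $\boldsymbol\rho=\mathbf{v}\mathbf{v}^\dagger$ for a unit vector $\mathbf{v}$. $\|\cdot\|_{\mathrm{op}}$ is the operator norm. *)

theory Defs
  imports "HOL-Analysis.Analysis"
begin

text \<open>
  A \<open>d\<close> by \<open>d\<close> complex matrix is an element of \<open>complex ^ 'd ^ 'd\<close> with \<open>d = CARD('d) \<ge> 1\<close>.
  Beware that \<open>*\<close> and \<open>^\<close> act entrywise on this type; the matrix product is \<open>**\<close>.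
\<close>

type_synonym 'd cmat = "complex ^ 'd ^ 'd"

definition dagger :: "'d::finite cmat \<Rightarrow> 'd cmat" where
  "dagger A = (\<chi> i j. cnj (A $ j $ i))"

definition hermitian :: "'d::finite cmat \<Rightarrow> bool" where
  "hermitian A \<longleftrightarrow> dagger A = A"

definition unitary :: "'d::finite cmat \<Rightarrow> bool" where
  "unitary A \<longleftrightarrow> dagger A ** A = mat 1 \<and> A ** dagger A = mat 1"

definition is_eigenvalue :: "'d::finite cmat \<Rightarrow> complex \<Rightarrow> bool" where
  "is_eigenvalue A c \<longleftrightarrow> (\<exists>v. v \<noteq> 0 \<and> A *v v = c *s v)"

text \<open>For Hermitian \<open>A\<close> the quadratic form is real, so taking \<open>Re\<close> loses nothing.\<close>

definition pos_semidef :: "'d::finite cmat \<Rightarrow> bool" where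
  "pos_semidef A \<longleftrightarrow> hermitian A \<and> (\<forall>v. 0 \<le> Re (\<Sum>i\<in>UNIV. cnj (v $ i) * (A *v v) $ i))"

definition quantum_state :: "'d::finite cmat \<Rightarrow> bool" where
  "quantum_state A \<longleftrightarrow> pos_semidef A \<and> trace A = 1"

definition pure_state :: "'d::finite cmat \<Rightarrow> bool" where
  "pure_state A \<longleftrightarrow> quantum_state A \<and> rank A = 1"

text \<open>The norm on \<open>complex ^ 'd\<close> is the Euclidean one.\<close>

definition op_norm :: "'d::finite cmat \<Rightarrow> real" where
  "op_norm A = onorm ((*v) A)"

definition cscale :: "complex \<Rightarrow> 'd::finite cmat \<Rightarrow> 'd cmat" where
  "cscale c A = (\<chi> i j. c * A $ i $ j)"

primrec mat_power :: "'d::finite cmat \<Rightarrow> nat \<Rightarrow> 'd cmat" where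
  "mat_power A 0 = mat 1"
| "mat_power A (Suc n) = A ** mat_power A n"

text \<open>The library's \<open>exp\<close> needs a normed algebra, and the matrix type is no instance of that class.\<close>

definition mat_exp :: "'d::finite cmat \<Rightarrow> 'd cmat" where
  "mat_exp A = (\<Sum>n. mat_power A n /\<^sub>R fact n)"

text \<open>
  A parameter vector in \<open>p\<close>-dimensional real space is a function \<open>\<theta> :: nat \<Rightarrow> real\<close> of which only
  \<open>\<theta> 1, \<dots>, \<theta> p\<close> are used: the factors of the ansatz are ordered by their index. In
  \<open>ansatz U H p \<theta>\<close> the later layers stand to the left, and \<open>H 0\<close> is not used.
\<close>

primrec ansatz :: "(nat \<Rightarrow> 'd::finite cmat) \<Rightarrow> (nat \<Rightarrow> 'd cmat) \<Rightarrow> nat \<Rightarrow> (nat \<Rightarrow> real) \<Rightarrow> 'd cmat" where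
  "ansatz U H 0 \<theta> = U 0"
| "ansatz U H (Suc l) \<theta> =
     U (Suc l) ** mat_exp (cscale (- \<i> * of_real (\<theta> (Suc l))) (H (Suc l))) ** ansatz U H l \<theta>"

definition partial_deriv :: "nat \<Rightarrow> ((nat \<Rightarrow> real) \<Rightarrow> real) \<Rightarrow> (nat \<Rightarrow> real) \<Rightarrow> real" where
  "partial_deriv l f \<theta> = deriv (\<lambda>x. f (\<theta>(l := x))) (\<theta> l)"

text \<open>
  At \<open>t = 0\<close> the derivative of the curve is one-sided. The value of \<open>deriv\<close> is meaningful only for
  objectives \<open>f\<close> with partial derivatives in the coordinates \<open>1, \<dots>, p\<close>.
\<close>

definition gradient_flow :: "nat \<Rightarrow> real \<Rightarrow> ((nat \<Rightarrow> real) \<Rightarrow> real) \<Rightarrow> (real \<Rightarrow> nat \<Rightarrow> real) \<Rightarrow> bool" where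
  "gradient_flow p \<eta> f \<theta> \<longleftrightarrow>
     (\<forall>t\<ge>0. \<forall>l\<in>{1..p}.
        ((\<lambda>s. \<theta> s l) has_real_derivative - \<eta> * partial_deriv l f (\<theta> t)) (at t within {0..}))"

definition rotated_observable ::
  "'d::finite cmat \<Rightarrow> (nat \<Rightarrow> 'd cmat) \<Rightarrow> (nat \<Rightarrow> 'd cmat) \<Rightarrow> nat \<Rightarrow> (nat \<Rightarrow> real) \<Rightarrow> 'd cmat" where
  "rotated_observable M0 U H p \<theta> = dagger (ansatz U H p \<theta>) ** M0 ** ansatz U H p \<theta>"

text \<open>The trace of a product of two Hermitian matrices is real, so \<open>Re\<close> is only a coercion here.\<close>

definition loss ::
  "nat \<Rightarrow> (nat \<Rightarrow> 'd::finite cmat) \<Rightarrow> (nat \<Rightarrow> real) \<Rightarrow> 'd cmat \<Rightarrow> real" where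
  "loss m \<rho> y M = 1 / (2 * real m) * (\<Sum>j=1..m. (Re (trace (\<rho> j ** M)) - y j)\<^sup>2)"

end

theory Submission
  imports Defs
begin

text \<open>
  Write \<open>f\<^sub>j = \<langle>V v\<^sub>j, M\<^sub>0 V v\<^sub>j\<rangle>\<close> for the predictions, where \<open>\<rho>\<^sub>j = v\<^sub>j v\<^sub>j\<^sup>\<dagger>\<close> and \<open>V = U(\<theta>)\<close>. As
  \<open>M\<^sub>0\<close> is a Hermitian involution, the component of \<open>M\<^sub>0 V v\<^sub>j\<close> orthogonal to \<open>V v\<^sub>j\<close> has norm
  \<open>sqrt (1 - f\<^sub>j\<^sup>2)\<close>, and only this component enters the partial derivatives:
  \<open>\<bar>\<partial>\<^sub>k f\<^sub>j\<bar> \<le> 2 \<parallel>H\<^sub>k\<parallel> sqrt (1 - f\<^sub>j\<^sup>2) \<le> 2 \<parallel>H\<^sub>k\<parallel> sqrt (2 \<bar>f\<^sub>j - y\<^sub>j\<bar>)\<close>. Two applications of the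
  Cauchy-Schwarz inequality turn this into \<open>(\<partial>\<^sub>k L)\<^sup>2 \<le> 16 sqrt 2 \<parallel>H\<^sub>k\<parallel>\<^sup>2 L\<^bsup>3/2\<^esup>\<close>, and
  \<open>16 sqrt 2 \<le> 24\<close>. Hence \<open>dL/dt \<ge> - 2 c\<^sub>1 L\<^bsup>3/2\<^esup>\<close> along the flow, which says that
  \<open>L\<^bsup>-1/2\<^esup>\<close> grows at most at the rate \<open>c\<^sub>1\<close>.
\<close>

section \<open>Eigenvectors of self-adjoint maps\<close>

text \<open>A maximiser \<open>x\<close> of the quadratic form \<open>inner x (f x)\<close> on the
  unit sphere of \<open>S\<close> does the job. The residual \<open>w\<close> of \<open>f x\<close>
  after projection to \<open>x\<close> lies in \<open>S\<close> by invariance and is orthogonal to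
  \<open>x\<close>; moving \<open>x\<close> along \<open>w\<close> would raise the Rayleigh quotient
  to first order unless \<open>w = 0\<close>.\<close>

lemma selfadjoint_eigenvector:
  fixes f :: "'a::euclidean_space \<Rightarrow> 'a"
  assumes lin: "linear f" and sa: "\<And>x y. inner (f x) y = inner x (f y)"
    and S: "subspace S" "f ` S \<subseteq> S" "S \<noteq> {0}"
  obtains x c where "x \<in> S" "x \<noteq> 0" "f x = c *\<^sub>R x"
proof -
  obtain s where s: "s \<in> S" "s \<noteq> 0"
    using S by (metis subspace_0 subsetI subset_singletonD singleton_iff empty_iff)
  let ?K = "S \<inter> sphere 0 1"
  have "compact ?K"
    by (simp add: closed_subspace[OF S(1)] compact_Int_closed Int_commute closed_Int_compact)
  moreover have "s /\<^sub>R norm s \<in> ?K"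
    using s S(1) by (simp add: subspace_scale)
  moreover have "continuous_on ?K (\<lambda>x. inner x (f x))"
    by (intro continuous_intros linear_continuous_on linear_conv_bounded_linear[THEN iffD1] lin)
  ultimately obtain x where x: "x \<in> ?K" and sup: "\<forall>y\<in>?K. inner y (f y) \<le> inner x (f x)"
    using continuous_attains_sup[of ?K "\<lambda>x. inner x (f x)"] by blast
  define c where "c = inner x (f x)"
  have nx: "norm x = 1" and xS: "x \<in> S" using x by auto
  have xx: "inner x x = 1" using nx by (simp add: norm_eq_1)
  have le: "inner y (f y) \<le> c * inner y y" if "y \<in> S" for y
  proof (cases "y = 0")
    case False
    then have "y /\<^sub>R norm y \<in> ?K" using that S(1) by (simp add: subspace_scale)
    then have "inner (y /\<^sub>R norm y) (f (y /\<^sub>R norm y)) \<le> c" using sup c_def by blast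
    then show ?thesis using False
      by (simp add: linear_scale[OF lin] power2_norm_eq_inner[symmetric] field_simps power2_eq_square)
  qed (simp add: linear_0[OF lin])
  define w where "w = f x - c *\<^sub>R x"
  have wS: "w \<in> S" using xS S by (auto simp: w_def intro!: subspace_diff subspace_scale)
  have xw: "inner x w = 0" by (simp add: w_def inner_diff_right c_def xx)
  have wfx: "inner w (f x) = inner w w"
    using xw by (simp add: w_def inner_diff_right inner_commute)
  \<comment> \<open>Maximality tested at the competitor \<open>x + t *\<^sub>R w\<close>, as a
    polynomial in \<open>t\<close> without constant term.\<close>
  have poly: "2 * t * inner w w + t\<^sup>2 * (inner w (f w) - c * inner w w) \<le> 0" for t
  proof -
    have "x + t *\<^sub>R w \<in> S" using xS wS S(1) by (simp add: subspace_add subspace_scale)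
    from le[OF this] have "inner (x + t *\<^sub>R w) (f x + t *\<^sub>R f w) \<le> c * (1 + t\<^sup>2 * inner w w)"
      by (simp add: linear_add[OF lin] linear_scale[OF lin] inner_add_left inner_add_right xx xw
          inner_commute[of w x] power2_eq_square mult.assoc)
    moreover have "inner x (f w) = inner w w" using sa[of x w] wfx by (simp add: inner_commute)
    ultimately show ?thesis using wfx
      by (simp add: inner_add_left inner_add_right c_def[symmetric] power2_eq_square algebra_simps)
  qed
  have "inner w w = 0"
  proof (rule ccontr)
    assume "inner w w \<noteq> 0"
    then have a: "inner w w > 0" by (simp add: inner_gt_zero_iff)
    define b where "b = inner w (f w) - c * inner w w"
    \<comment> \<open>Small enough that the quadratic term cannot outweigh the positive linear
      one.\<close>
    define t where "t = inner w w / (\<bar>b\<bar> + 1)"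
    have t: "t > 0" using a by (simp add: t_def)
    have "t * \<bar>b\<bar> \<le> inner w w"
      using a by (simp add: t_def field_simps mult_left_mono)
    then have "2 * inner w w + t * b > 0"
      using a t by (smt (verit) abs_ge_minus_self minus_mult_right mult_left_mono)
    then have "t * (2 * inner w w + t * b) > 0" using t by simp
    with poly[of t] show False by (simp add: b_def power2_eq_square algebra_simps)
  qed
  then have "f x = c *\<^sub>R x" by (simp add: w_def)
  with xS nx that[of x c] show thesis by force
qed

section \<open>Adjoints, unitary matrices, the operator norm and Hermitian involutions\<close>

lemma inner_complex_eq_Re: "inner (x::complex) y = Re (cnj x * y)"
  by (simp add: inner_complex_def)

text \<open>The geometry below uses the real inner product of \<open>complex ^ 'd\<close>, which is
  the real part of the Hermitian form. Expectations of Hermitian matrices are real, so they are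
  captured exactly.\<close>

lemma inner_cvec: "inner x (y::complex^'d::finite) = Re (\<Sum>i\<in>UNIV. cnj (x $ i) * y $ i)"
  by (simp add: inner_vec_def inner_complex_eq_Re)

lemma inner_cmat_mult_left: "inner (A *v x) y = inner x (dagger A *v y)"
proof -
  have "(\<Sum>i\<in>UNIV. cnj ((A *v x) $ i) * y $ i) = (\<Sum>i\<in>UNIV. \<Sum>j\<in>UNIV. cnj (A$i$j) * cnj (x$j) * y$i)"
    by (simp add: matrix_vector_mult_def sum_distrib_right)
  also have "\<dots> = (\<Sum>j\<in>UNIV. \<Sum>i\<in>UNIV. cnj (A$i$j) * cnj (x$j) * y$i)"
    by (rule sum.swap)
  also have "\<dots> = (\<Sum>j\<in>UNIV. cnj (x $ j) * (dagger A *v y) $ j)"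
    by (simp add: matrix_vector_mult_def dagger_def sum_distrib_left mult_ac)
  finally show ?thesis by (simp only: inner_cvec)
qed

lemma dagger_dagger [simp]: "dagger (dagger A) = A"
  by (simp add: dagger_def vec_eq_iff)

lemma dagger_mult: "dagger (A ** B) = dagger B ** dagger A"
  by (simp add: dagger_def matrix_matrix_mult_def vec_eq_iff mult.commute)

lemma inner_unitary: "unitary A \<Longrightarrow> inner (A *v x) (A *v y) = inner x y"
  by (simp add: unitary_def inner_cmat_mult_left matrix_vector_mul_assoc)

lemma unitary_dagger: "unitary A \<Longrightarrow> unitary (dagger A)"
  by (simp add: unitary_def)

lemma unitary_mult:
  assumes "unitary A" "unitary B" shows "unitary (A ** B)"
proof -
  have "dagger B ** dagger A ** (A ** B) = dagger B ** (dagger A ** A) ** B"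
    "A ** B ** (dagger B ** dagger A) = A ** (B ** dagger B) ** dagger A"
    by (simp_all only: matrix_mul_assoc)
  with assms show ?thesis by (simp add: unitary_def dagger_mult)
qed

lemma norm_unitary: "unitary A \<Longrightarrow> norm (A *v x) = norm x"
  by (simp add: norm_eq_sqrt_inner inner_unitary)

lemma norm_mult_op_norm: "norm (A *v x) \<le> op_norm A * norm x"
  unfolding op_norm_def by (rule onorm) simp

lemma op_norm_nonneg: "0 \<le> op_norm A"
  unfolding op_norm_def by (rule onorm_pos_le) simp

text \<open>The range of \<open>M\<^sup>2 - 1\<close> is orthogonal to its kernel, but if it were nonzero it would contain
  an eigenvector of \<open>M\<close>.\<close>

lemma hermitian_involution:
  assumes M: "hermitian M" and ev: "\<And>c. is_eigenvalue M c \<Longrightarrow> c \<in> {1, -1}"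
  shows "M *v (M *v x) = x"
proof -
  have sa: "inner (M *v x) y = inner x (M *v y)" for x y
    using M by (simp add: inner_cmat_mult_left hermitian_def)
  let ?N = "\<lambda>x. M *v (M *v x) - x"
  have linM: "linear ((*v) M)" by (rule bounded_linear.linear) simp
  have linN: "linear ?N"
    by (rule linearI) (simp_all add: linear_add[OF linM] linear_scale[OF linM] scaleR_diff_right)
  let ?S = "range ?N"
  have "?S = {0}"
  proof (rule ccontr)
    assume ne: "?S \<noteq> {0}"
    have inv: "(*v) M ` ?S \<subseteq> ?S"
      by (auto simp: matrix_vector_mult_diff_distrib)
    obtain x c where x: "x \<in> ?S" "x \<noteq> 0" "M *v x = c *\<^sub>R x"
      by (rule selfadjoint_eigenvector[OF linM sa linear_subspace_image[OF linN subspace_UNIV] inv ne])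
    then have "M *v x = complex_of_real c *s x"
      by (simp add: vec_eq_iff scaleR_conv_of_real[where 'a = complex])
    then have "is_eigenvalue M (complex_of_real c)" using x unfolding is_eigenvalue_def by blast
    then have "c = 1 \<or> c = -1" using ev[of "complex_of_real c"]
      by (auto simp: complex_eq_iff)
    then have "M *v (M *v x) = x" using x(3) by (auto simp: linear_neg[OF linM])
    moreover obtain z where z: "x = ?N z" using x by blast
    have "inner x x = inner (M *v (M *v x)) z - inner x z"
      by (subst (2) z) (simp add: inner_diff_right sa)
    ultimately have "inner x x = 0" by simp
    with x show False by simp
  qed
  then have "?N x = 0" by blast
  then show ?thesis by simp
qed

section \<open>Pure states and the variance of an involution\<close>

text \<open>Rank one gives \<open>A $ i $ j = u i * w $ j\<close>. Trace one makes \<open>A\<close>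
  idempotent, and with Hermiticity \<open>A\<close> equals \<open>A ** dagger A\<close>, whose
  entries are \<open>r * u i * cnj (u j)\<close> with \<open>r\<close> the squared norm of
  \<open>w\<close>. Hence \<open>v\<close> is \<open>u\<close> scaled by
  \<open>sqrt r\<close>.\<close>

lemma pure_state_rank_one:
  assumes "pure_state A"
  obtains v where "norm v = 1" "\<And>i j. A $ i $ j = v $ i * cnj (v $ j)"
proof -
  have h: "dagger A = A" and tr: "trace A = 1" and rk: "vec.dim (rows A) = 1"
    using assms
    by (auto simp: pure_state_def quantum_state_def pos_semidef_def hermitian_def row_rank_def_gen)
  obtain B where B: "rows A \<subseteq> vec.span B" "card B = vec.dim (rows A)"
    using vec.basis_exists[of "rows A"] by metis
  then obtain w where "B = {w}" using rk by (metis card_1_singletonE)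
  then have "\<exists>c. row i A = c *s w" for i
    using B(1) by (auto simp: rows_def vec.span_singleton)
  then obtain u where "\<And>i. row i A = u i *s w" by metis
  then have A: "A $ i $ j = u i * w $ j" for i j
    by (metis row_def vec_lambda_eta vector_smult_component)
  have h': "cnj (A $ j $ i) = A $ i $ j" for i j
    using arg_cong[OF h, of "\<lambda>B. B $ i $ j"] by (simp add: dagger_def)
  have tr': "(\<Sum>k\<in>UNIV. u k * w $ k) = 1" using tr by (simp add: trace_def A)
  define r where "r = (\<Sum>k\<in>UNIV. (norm (w $ k))\<^sup>2)"
  have sq: "A $ i $ j = of_real r * (u i * cnj (u j))" for i j
  proof -
    have "A $ i $ j = (\<Sum>k\<in>UNIV. u k * w $ k) * (u i * w $ j)" by (simp add: tr' A)
    also have "\<dots> = (\<Sum>k\<in>UNIV. A $ i $ k * A $ k $ j)"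
      by (simp add: A sum_distrib_left sum_distrib_right mult_ac)
    also have "\<dots> = (\<Sum>k\<in>UNIV. A $ i $ k * cnj (A $ j $ k))" by (simp add: h')
    also have "\<dots> = (\<Sum>k\<in>UNIV. of_real ((norm (w $ k))\<^sup>2) * (u i * cnj (u j)))"
      by (simp add: A complex_norm_square[unfolded of_real_power] mult_ac)
    finally show ?thesis by (simp add: r_def sum_distrib_right)
  qed
  have r0: "r \<ge> 0" by (simp add: r_def sum_nonneg)
  define v :: "complex^'a" where "v = (\<chi> i. of_real (sqrt r) * u i)"
  have v: "A $ i $ j = v $ i * cnj (v $ j)" for i j
  proof -
    have "v $ i * cnj (v $ j) = of_real (sqrt r) * of_real (sqrt r) * (u i * cnj (u j))"
      by (simp add: v_def mult_ac)
    also have "\<dots> = of_real (sqrt r * sqrt r) * (u i * cnj (u j))" by (simp only: of_real_mult)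
    finally have "v $ i * cnj (v $ j) = of_real (sqrt r * sqrt r) * (u i * cnj (u j))" .
    moreover have "sqrt r * sqrt r = r" using r0 by simp
    ultimately show ?thesis by (simp only: sq)
  qed
  have "inner v v = Re (trace A)" by (simp add: inner_cvec trace_def v mult_ac)
  then have "norm v = 1" using tr by (simp add: norm_eq_1)
  with v that show thesis by blast
qed

lemma trace_rank_one:
  assumes "\<And>i j. A $ i $ j = v $ i * cnj (v $ j)"
  shows "Re (trace (A ** M)) = inner v (M *v v)"
proof -
  have "trace (A ** M) = (\<Sum>i\<in>UNIV. \<Sum>k\<in>UNIV. v $ i * cnj (v $ k) * M $ k $ i)"
    by (simp add: trace_def matrix_matrix_mult_def assms)
  also have "\<dots> = (\<Sum>k\<in>UNIV. cnj (v $ k) * (M *v v) $ k)"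
    by (subst sum.swap) (simp add: matrix_vector_mult_def sum_distrib_left mult_ac)
  finally show ?thesis by (simp add: inner_cvec)
qed

text \<open>A self-adjoint involution is an isometry, so by Pythagoras the residual \<open>r\<close>
  of \<open>f x\<close> after projection to \<open>x\<close> has squared norm
  \<open>1 - (inner x (f x))^2\<close>, the variance of the observable. A vector \<open>z\<close>
  orthogonal to \<open>x\<close> sees only \<open>r\<close>.\<close>

lemma abs_inner_involution_le:
  assumes sa: "\<And>x y. inner (f x) y = inner x (f y)" and inv: "\<And>x. f (f x) = x"
    and x: "norm x = 1" and xz: "inner z x = 0"
  shows "\<bar>inner z (f x)\<bar> \<le> norm z * sqrt (1 - (inner x (f x))\<^sup>2)"
proof -
  define r where "r = f x - inner x (f x) *\<^sub>R x"
  have "inner (f x) (f x) = 1" using sa inv x by (simp add: norm_eq_1)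
  then have "(norm r)\<^sup>2 = 1 - (inner x (f x))\<^sup>2"
    using x by (simp add: r_def power2_norm_eq_inner inner_diff_left inner_diff_right norm_eq_1
        inner_commute[of "f x" x] power2_eq_square[of "inner x (f x)"])
  then have "norm r = sqrt (1 - (inner x (f x))\<^sup>2)" by (metis norm_ge_zero real_sqrt_unique)
  moreover have "inner z (f x) = inner z r" using xz by (simp add: r_def inner_diff_right)
  ultimately show ?thesis using Cauchy_Schwarz_ineq2[of z r] by simp
qed

section \<open>The matrix exponential as a power series in each entry\<close>

lemma norm_axis: "norm (axis i x) = norm (x :: 'a::real_normed_vector)"
proof -
  have "(\<Sum>j\<in>UNIV. (norm (axis i x $ j))\<^sup>2) = (\<Sum>j\<in>UNIV. if j = i then (norm x)\<^sup>2 else 0)"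
    by (intro sum.cong) (auto simp: axis_def)
  then show ?thesis by (simp add: norm_vec_def L2_set_def)
qed

lemma norm_mat_power_mult: "norm (mat_power A n *v x) \<le> op_norm A ^ n * norm x"
proof (induction n)
  case (Suc n)
  have "norm (mat_power A (Suc n) *v x) \<le> op_norm A * norm (mat_power A n *v x)"
    by (simp add: norm_mult_op_norm flip: matrix_vector_mul_assoc)
  also have "\<dots> \<le> op_norm A * (op_norm A ^ n * norm x)"
    by (intro mult_left_mono Suc op_norm_nonneg)
  finally show ?case by (simp add: mult_ac)
qed simp

lemma norm_mat_power_entry: "norm (mat_power A n $ i $ j) \<le> op_norm A ^ n"
proof -
  have "mat_power A n $ i $ j = (mat_power A n *v axis j 1) $ i"
    by (simp add: matrix_vector_mult_def axis_def if_distrib cong: if_cong)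
  also have "norm \<dots> \<le> op_norm A ^ n * norm (axis j (1::complex))"
    by (rule order_trans[OF Finite_Cartesian_Product.norm_nth_le norm_mat_power_mult])
  finally show ?thesis by (simp add: norm_axis)
qed

lemma summable_mat_exp_entry: "summable (\<lambda>n. mat_power A n $ i $ j / fact n * z ^ n)"
proof (rule summable_comparison_test')
  show "summable (\<lambda>n. inverse (fact n) * (op_norm A * norm z) ^ n)" by (rule summable_exp)
  fix n :: nat
  show "norm (mat_power A n $ i $ j / fact n * z ^ n) \<le> inverse (fact n) * (op_norm A * norm z) ^ n"
    using mult_left_mono[OF norm_mat_power_entry[of A n i j], of "norm z ^ n"]
    by (simp add: norm_mult norm_divide norm_power power_mult_distrib field_simps)
qed

lemma mat_power_cscale: "mat_power (cscale z A) n = cscale (z ^ n) (mat_power A n)"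
  by (induction n) (auto simp: cscale_def matrix_matrix_mult_def vec_eq_iff sum_distrib_left mult_ac)

lemma sums_vec:
  fixes f :: "nat \<Rightarrow> 'a::real_normed_vector ^ 'n::finite"
  assumes "\<And>i. (\<lambda>n. f n $ i) sums (x $ i)"
  shows "f sums x"
  using assms unfolding sums_def by (intro vec_tendstoI) (simp add: sum_component)

text \<open>Each entry is a scalar power series in \<open>z\<close>, which gives access to termwise
  differentiation.\<close>

lemma mat_exp_entry:
  "mat_exp (cscale z A) $ i $ j = (\<Sum>n. mat_power A n $ i $ j / fact n * z ^ n)"
proof -
  let ?X = "\<chi> i j. \<Sum>n. mat_power A n $ i $ j / fact n * z ^ n"
  have "(\<lambda>n. mat_power (cscale z A) n /\<^sub>R fact n) sums ?X"
  proof (intro sums_vec)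
    fix i j
    have "(\<lambda>n. mat_power A n $ i $ j / fact n * z ^ n) sums (?X $ i $ j)"
      by (simp only: vec_lambda_beta summable_sums[OF summable_mat_exp_entry])
    then show "(\<lambda>n. (mat_power (cscale z A) n /\<^sub>R fact n) $ i $ j) sums (?X $ i $ j)"
      unfolding mat_power_cscale by (simp add: cscale_def scaleR_conv_of_real[where 'a = complex] field_simps)
  qed
  then show ?thesis by (simp add: mat_exp_def sums_iff)
qed

lemma mat_exp_0: "mat_exp (cscale 0 A) = mat 1"
  by (simp add: vec_eq_iff mat_exp_entry powser_zero del: times_divide_eq_left)

lemma has_field_derivative_mat_exp_entry:
  "((\<lambda>z. mat_exp (cscale z A) $ i $ j) has_field_derivative (A ** mat_exp (cscale z A)) $ i $ j) (at z)"
proof -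
  let ?c = "\<lambda>n. mat_power A n $ i $ j / fact n"
  have "((\<lambda>z. \<Sum>n. ?c n * z ^ n) has_field_derivative (\<Sum>n. diffs ?c n * z ^ n)) (at z)"
    by (intro termdiffs_strong_converges_everywhere summable_mat_exp_entry)
  moreover have "(\<Sum>n. diffs ?c n * z ^ n) = (A ** mat_exp (cscale z A)) $ i $ j"
  proof -
    have "diffs ?c n * z ^ n = (\<Sum>k\<in>UNIV. A $ i $ k * (mat_power A n $ k $ j / fact n * z ^ n))" for n
    proof -
      \<comment> \<open>The index shift in \<open>diffs\<close> cancels \<open>Suc n\<close> against
        \<open>fact (Suc n)\<close>; the extra power then splits off as the factor \<open>A\<close>
        on the left.\<close>
      have "diffs ?c n = mat_power A (Suc n) $ i $ j / fact n"
        by (simp add: diffs_def field_simps del: of_nat_Suc mat_power.simps)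
      then show ?thesis
        by (simp add: matrix_matrix_mult_def sum_divide_distrib sum_distrib_right mult.assoc)
    qed
    then have "(\<Sum>n. diffs ?c n * z ^ n)
        = (\<Sum>k\<in>UNIV. \<Sum>n. A $ i $ k * (mat_power A n $ k $ j / fact n * z ^ n))"
      by (simp only: suminf_sum[OF summable_mult[OF summable_mat_exp_entry]])
    also have "\<dots> = (\<Sum>k\<in>UNIV. A $ i $ k * (\<Sum>n. mat_power A n $ k $ j / fact n * z ^ n))"
      by (intro sum.cong refl suminf_mult summable_mat_exp_entry)
    finally show ?thesis by (simp add: matrix_matrix_mult_def mat_exp_entry)
  qed
  ultimately show ?thesis by (simp add: mat_exp_entry)
qed

section \<open>Derivatives of matrix-valued curves\<close>

text \<open>The general entry type allows two applications to a matrix, first to its rows and then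
  to their entries.\<close>

lemma has_vector_derivative_vecI:
  fixes f :: "real \<Rightarrow> 'a::real_normed_vector ^ 'n::finite"
  assumes "\<And>i. ((\<lambda>s. f s $ i) has_vector_derivative f' $ i) F"
  shows "(f has_vector_derivative f') F"
proof -
  have eq: "x = (\<Sum>i\<in>UNIV. axis i (x $ i))" for x :: "'a ^ 'n"
    by (simp add: vec_eq_iff axis_def sum_component if_distrib cong: if_cong)
  have bl: "bounded_linear (axis i :: 'a \<Rightarrow> 'a ^ 'n)" for i
    by (rule bounded_linear_intro[where K = 1]) (auto simp: vec_eq_iff axis_def norm_axis[unfolded axis_def])
  have "((\<lambda>s. \<Sum>i\<in>UNIV. axis i (f s $ i)) has_vector_derivative (\<Sum>i\<in>UNIV. axis i (f' $ i))) F"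
    by (intro has_vector_derivative_sum bounded_linear.has_vector_derivative[OF bl] assms)
  then show ?thesis by (simp only: eq[symmetric])
qed

lemma has_vector_derivative_mat_exp:
  assumes "(\<tau> has_real_derivative \<omega>) (at t within S)"
  shows "((\<lambda>s. mat_exp (cscale (- \<i> * of_real (\<tau> s)) A)) has_vector_derivative
    \<omega> *\<^sub>R (cscale (- \<i>) A ** mat_exp (cscale (- \<i> * of_real (\<tau> t)) A))) (at t within S)"
proof (intro has_vector_derivative_vecI)
  fix i j
  have "((\<lambda>s. - \<i> * of_real (\<tau> s)) has_vector_derivative - \<i> * of_real \<omega>) (at t within S)"
    using assms by (intro has_vector_derivative_mult_right has_vector_derivative_of_real)
      (simp add: has_real_derivative_iff_has_vector_derivative)
  from field_vector_diff_chain_within[OF this, OF has_field_derivative_at_within,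
      OF has_field_derivative_mat_exp_entry[of A i j]]
  show "((\<lambda>s. mat_exp (cscale (- \<i> * of_real (\<tau> s)) A) $ i $ j) has_vector_derivative
    (\<omega> *\<^sub>R (cscale (- \<i>) A ** mat_exp (cscale (- \<i> * of_real (\<tau> t)) A))) $ i $ j) (at t within S)"
    by (simp add: o_def matrix_matrix_mult_def cscale_def scaleR_conv_of_real[where 'a = complex]
        sum_distrib_left mult_ac
        flip: sum_negf)
qed

lemma bounded_bilinear_cmat_mult: "bounded_bilinear ((**) :: 'd::finite cmat \<Rightarrow> 'd cmat \<Rightarrow> 'd cmat)"
  unfolding bilinear_conv_bounded_bilinear[symmetric] bilinear_def
  by (auto intro!: linearI simp: matrix_add_ldistrib matrix_matrix_mult_def vec_eq_iff
      sum.distrib scaleR_sum_right distrib_left distrib_right)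

lemma bounded_linear_cmat_mult_vec: "bounded_linear (\<lambda>A::'d::finite cmat. A *v x)"
  unfolding linear_conv_bounded_linear[symmetric]
  by (auto intro!: linearI simp: matrix_vector_mult_def vec_eq_iff sum.distrib scaleR_sum_right distrib_right)

lemma bounded_linear_dagger: "bounded_linear (dagger :: 'd::finite cmat \<Rightarrow> 'd cmat)"
  unfolding linear_conv_bounded_linear[symmetric]
  by (auto intro!: linearI simp: dagger_def vec_eq_iff)

lemma dagger_cscale_hermitian: "hermitian A \<Longrightarrow> dagger (cscale (- \<i>) A) = - cscale (- \<i>) A"
  by (simp add: hermitian_def dagger_def cscale_def vec_eq_iff)

text \<open>The product \<open>dagger (?E s) ** ?E s\<close> is constant in \<open>s\<close>: its
  two product-rule terms cancel because \<open>?K\<close> is skew-Hermitian. At \<open>s = 0\<close>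
  it is the identity.\<close>

lemma unitary_mat_exp:
  assumes "hermitian A"
  shows "unitary (mat_exp (cscale (- \<i> * of_real x) A))"
proof -
  let ?K = "cscale (- \<i>) A"
  let ?E = "\<lambda>s. mat_exp (cscale (- \<i> * of_real s) A)"
  interpret bounded_bilinear "(**) :: 'a cmat \<Rightarrow> 'a cmat \<Rightarrow> 'a cmat"
    by (rule bounded_bilinear_cmat_mult)
  have "((\<lambda>s. dagger (?E s) ** ?E s) has_derivative (\<lambda>h. 0)) (at s within UNIV)" for s
  proof -
    have E: "(?E has_vector_derivative ?K ** ?E s) (at s)"
      using has_vector_derivative_mat_exp[OF DERIV_ident, of A] by simp
    have "((\<lambda>s. dagger (?E s) ** ?E s) has_vector_derivative
        dagger (?E s) ** (?K ** ?E s) + dagger (?K ** ?E s) ** ?E s) (at s)"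
      by (intro has_vector_derivative bounded_linear.has_vector_derivative[OF bounded_linear_dagger] E)
    also have "dagger (?E s) ** (?K ** ?E s) + dagger (?K ** ?E s) ** ?E s = 0"
      by (simp add: dagger_mult dagger_cscale_hermitian[OF assms] minus_left minus_right matrix_mul_assoc)
    finally show ?thesis by (simp add: has_vector_derivative_def)
  qed
  then have "dagger (?E x) ** ?E x = dagger (?E 0) ** ?E 0"
    by (intro has_derivative_zero_unique[of UNIV "\<lambda>s. dagger (?E s) ** ?E s"]) simp_all
  also have "\<dots> = mat 1"
    by (simp add: mat_exp_0) (simp add: dagger_def mat_def vec_eq_iff)
  finally show ?thesis
    unfolding unitary_def using matrix_left_right_inverse by blast
qed

section \<open>The ansatz and its derivative\<close>

lemma unitary_ansatz:
  assumes "\<And>l. l \<in> {0..p} \<Longrightarrow> unitary (U l)" "\<And>l. l \<in> {1..p} \<Longrightarrow> hermitian (H l)"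
  shows "unitary (ansatz U H p \<theta>)"
  using assms
proof (induction p)
  case (Suc p)
  have "unitary (mat_exp (cscale (- \<i> * of_real (\<theta> (Suc p))) (H (Suc p))))"
    by (rule unitary_mat_exp) (simp add: Suc.prems)
  moreover have "unitary (ansatz U H p \<theta>)" "unitary (U (Suc p))" using Suc by auto
  ultimately show ?case by (simp only: ansatz.simps unitary_mult)
qed simp

text \<open>In terms of these skew-Hermitian matrices \<open>Q\<^sub>k\<close>, the derivative of \<open>ansatz U H p\<close> in
  the direction \<open>\<omega>\<close> is \<open>ansatz U H p \<theta> ** (\<Sum>k=1..p. \<omega> k *\<^sub>R Q\<^sub>k)\<close>.\<close>

definition pulled_back_gen ::
  "(nat \<Rightarrow> 'd::finite cmat) \<Rightarrow> (nat \<Rightarrow> 'd cmat) \<Rightarrow> (nat \<Rightarrow> real) \<Rightarrow> nat \<Rightarrow> 'd cmat" where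
  "pulled_back_gen U H \<theta> k =
    (let W = mat_exp (cscale (- \<i> * of_real (\<theta> k)) (H k)) ** ansatz U H (k - 1) \<theta>
     in dagger W ** cscale (- \<i>) (H k) ** W)"

text \<open>A curve of parameters with velocity \<open>\<omega>\<close>, differentiated within
  \<open>S\<close>, covers both coordinate lines and the flow, whose derivative at time 0 is
  one-sided. The induction is the product rule.\<close>

lemma has_vector_derivative_ansatz:
  assumes "\<And>l. l \<in> {0..p} \<Longrightarrow> unitary (U l)" "\<And>l. l \<in> {1..p} \<Longrightarrow> hermitian (H l)"
    and "\<And>k. k \<in> {1..p} \<Longrightarrow> ((\<lambda>s. \<theta> s k) has_real_derivative \<omega> k) (at t within S)"
  shows "((\<lambda>s. ansatz U H p (\<theta> s)) has_vector_derivative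
    ansatz U H p (\<theta> t) ** (\<Sum>k=1..p. \<omega> k *\<^sub>R pulled_back_gen U H (\<theta> t) k)) (at t within S)"
  using assms
proof (induction p)
  case 0
  interpret bounded_bilinear "(**) :: 'a cmat \<Rightarrow> 'a cmat \<Rightarrow> 'a cmat"
    by (rule bounded_bilinear_cmat_mult)
  show ?case by (simp add: zero_right)
next
  case (Suc p)
  interpret bounded_bilinear "(**) :: 'a cmat \<Rightarrow> 'a cmat \<Rightarrow> 'a cmat"
    by (rule bounded_bilinear_cmat_mult)
  let ?u = "U (Suc p)" and ?K = "cscale (- \<i>) (H (Suc p))"
  let ?E = "\<lambda>s. mat_exp (cscale (- \<i> * of_real (\<theta> s (Suc p))) (H (Suc p)))"
  let ?V = "\<lambda>s. ansatz U H p (\<theta> s)"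
  let ?Q = "pulled_back_gen U H (\<theta> t)"
  let ?W = "?E t ** ?V t"
  let ?\<Sigma> = "\<Sum>k=1..p. \<omega> k *\<^sub>R ?Q k"
  have IH: "(?V has_vector_derivative ?V t ** ?\<Sigma>) (at t within S)"
    using Suc.prems by (intro Suc.IH) auto
  have E: "(?E has_vector_derivative \<omega> (Suc p) *\<^sub>R (?K ** ?E t)) (at t within S)"
    using Suc.prems by (intro has_vector_derivative_mat_exp) auto
  have "unitary ?W"
    using Suc.prems by (intro unitary_mult unitary_mat_exp unitary_ansatz) auto
  then have W: "?W ** dagger ?W = mat 1" by (simp add: unitary_def)
  have "((\<lambda>s. ?u ** ?E s ** ?V s) has_vector_derivative
      ?u ** ?E t ** (?V t ** ?\<Sigma>)
      + (?u ** (\<omega> (Suc p) *\<^sub>R (?K ** ?E t)) + 0 ** ?E t) ** ?V t) (at t within S)"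
    by (intro has_vector_derivative IH E has_vector_derivative_const)
  \<comment> \<open>Inserting \<open>?W ** dagger ?W = mat 1\<close> moves the new generator
    \<open>?K\<close> to the right end of the product.\<close>
  moreover have "?u ** ?E t ** ?V t ** ?Q (Suc p) = ?u ** ?K ** ?E t ** ?V t"
  proof -
    have "?u ** ?E t ** ?V t ** ?Q (Suc p) = ?u ** (?W ** dagger ?W) ** ?K ** ?W"
      by (simp only: pulled_back_gen_def Let_def diff_Suc_1 matrix_mul_assoc)
    then show ?thesis unfolding W by (simp add: matrix_mul_assoc)
  qed
  ultimately show ?case
    by (simp add: zero_left add_right scaleR_left scaleR_right matrix_mul_assoc add.commute)
qed

lemma dagger_pulled_back_gen:
  assumes "hermitian (H k)"
  shows "dagger (pulled_back_gen U H \<theta> k) = - pulled_back_gen U H \<theta> k"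
proof -
  interpret bounded_bilinear "(**) :: 'a cmat \<Rightarrow> 'a cmat \<Rightarrow> 'a cmat"
    by (rule bounded_bilinear_cmat_mult)
  show ?thesis
    by (simp add: pulled_back_gen_def Let_def dagger_mult dagger_cscale_hermitian[OF assms]
        minus_left minus_right matrix_mul_assoc)
qed

text \<open>Conjugation by a unitary matrix and the factor \<open>- \<i>\<close> both preserve
  norms, so the bound for \<open>H k\<close> carries over.\<close>

lemma norm_pulled_back_gen_mult:
  assumes "\<And>l. l \<in> {0..p} \<Longrightarrow> unitary (U l)" "\<And>l. l \<in> {1..p} \<Longrightarrow> hermitian (H l)" "k \<in> {1..p}"
  shows "norm (pulled_back_gen U H \<theta> k *v v) \<le> op_norm (H k) * norm v"
proof -
  define W where "W = mat_exp (cscale (- \<i> * of_real (\<theta> k)) (H k)) ** ansatz U H (k - 1) \<theta>"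
  have W: "unitary W" unfolding W_def
    using assms by (intro unitary_mult unitary_mat_exp unitary_ansatz) auto
  have "pulled_back_gen U H \<theta> k *v v = dagger W *v (cscale (- \<i>) (H k) *v (W *v v))"
    by (simp only: pulled_back_gen_def Let_def W_def matrix_vector_mul_assoc matrix_mul_assoc)
  then have "norm (pulled_back_gen U H \<theta> k *v v) = norm (cscale (- \<i>) (H k) *v (W *v v))"
    using W by (simp add: norm_unitary unitary_dagger)
  also have "cscale (- \<i>) (H k) *v (W *v v) = (- \<i>) *s (H k *v (W *v v))"
    by (simp add: cscale_def matrix_vector_mult_def vec_eq_iff sum_distrib_left mult_ac flip: sum_negf)
  also have "norm \<dots> = norm (H k *v (W *v v))"
    by (simp add: norm_vec_def norm_mult)
  also have "\<dots> \<le> op_norm (H k) * norm v"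
    using norm_mult_op_norm[of "H k" "W *v v"] W by (simp add: norm_unitary)
  finally show ?thesis .
qed

section \<open>A scalar differential inequality\<close>

text \<open>The one-sided derivative at 0 enters only through continuity; at interior points the
  derivative is two-sided and the mean value argument applies.\<close>

lemma mono_on_half_line:
  fixes g g' :: "real \<Rightarrow> real"
  assumes d: "\<And>t. t \<ge> 0 \<Longrightarrow> (g has_real_derivative g' t) (at t within {0..})"
    and "\<And>t. t \<ge> 0 \<Longrightarrow> 0 \<le> g' t" and "t \<ge> 0"
  shows "g 0 \<le> g t"
proof (rule DERIV_nonneg_imp_increasing_open[OF \<open>t \<ge> 0\<close>])
  show "continuous_on {0..t} g"
    by (rule continuous_on_subset[of "{0..}"])
      (auto simp: continuous_on_eq_continuous_within intro: DERIV_continuous d)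
  fix x assume "0 < x" "x < t"
  then have "at x within {0..} = at x" by (intro at_within_interior) simp
  with d[of x] assms(2)[of x] \<open>0 < x\<close> show "\<exists>y. (g has_real_derivative y) (at x) \<and> 0 \<le> y" by force
qed

text \<open>The derivative of \<open>1 / sqrt (g t)\<close> is
  \<open>- g' t / (2 * (g t * sqrt (g t)))\<close>, hence at most \<open>c\<close>. Dividing by
  \<open>g t\<close> requires strict positivity at all times, which is established first.\<close>

lemma sublinear_decay:
  fixes g g' :: "real \<Rightarrow> real"
  assumes d: "\<And>t. t \<ge> 0 \<Longrightarrow> (g has_real_derivative g' t) (at t within {0..})"
    and nonneg: "\<And>t. t \<ge> 0 \<Longrightarrow> 0 \<le> g t" and decr: "\<And>t. t \<ge> 0 \<Longrightarrow> g' t \<le> 0"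
    and low: "\<And>t. t \<ge> 0 \<Longrightarrow> - (2 * c * (g t * sqrt (g t))) \<le> g' t"
    and pos0: "0 < g 0" and c: "0 \<le> c" and t: "t \<ge> 0"
  shows "1 / (1 / sqrt (g 0) + c * t)\<^sup>2 \<le> g t"
proof -
  have le0: "g s \<le> g 0" if "s \<ge> 0" for s
    using mono_on_half_line[of "\<lambda>t. - g t" "\<lambda>t. - g' t", OF _ _ that] d decr
    by (force intro!: derivative_eq_intros)
  \<comment> \<open>As \<open>g\<close> never exceeds \<open>g 0\<close>, the hypothesis weakens to
    the linear inequality \<open>g' \<ge> - K * g\<close>. So \<open>g s * exp (K * s)\<close> is
    nondecreasing, and \<open>g\<close> cannot reach zero in finite time.\<close>
  define K where "K = 2 * c * sqrt (g 0)"
  have pos: "g s > 0" if s: "s \<ge> 0" for s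
  proof -
    have "g 0 * exp (K * 0) \<le> g s * exp (K * s)"
    proof (rule mono_on_half_line[where g' = "\<lambda>s. g' s * exp (K * s) + K * exp (K * s) * g s", OF _ _ s])
      fix t :: real assume t: "t \<ge> 0"
      show "((\<lambda>s. g s * exp (K * s)) has_real_derivative g' t * exp (K * t) + K * exp (K * t) * g t)
          (at t within {0..})"
        using d[OF t] by (auto intro!: derivative_eq_intros)
      have "2 * c * (g t * sqrt (g t)) \<le> 2 * c * (g t * sqrt (g 0))"
        using c nonneg[OF t] le0[OF t] by (intro mult_left_mono) auto
      then have "0 \<le> g' t + K * g t" using low[OF t] by (simp add: K_def mult_ac)
      then have "0 \<le> exp (K * t) * (g' t + K * g t)" by simp
      then show "0 \<le> g' t * exp (K * t) + K * exp (K * t) * g t" by (simp add: algebra_simps)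
    qed
    then have "0 < g s * exp (K * s)" using pos0 by simp
    then show ?thesis by (simp add: zero_less_mult_iff)
  qed
  have "c * 0 - 1 / sqrt (g 0) \<le> c * t - 1 / sqrt (g t)"
  proof (rule mono_on_half_line[where g' = "\<lambda>t. c + g' t / (2 * (g t * sqrt (g t)))", OF _ _ t])
    fix t :: real assume t: "t \<ge> 0"
    show "((\<lambda>t. c * t - 1 / sqrt (g t)) has_real_derivative c + g' t / (2 * (g t * sqrt (g t))))
        (at t within {0..})"
      using d[OF t] pos[OF t] by (auto intro!: derivative_eq_intros simp: field_simps)
    show "0 \<le> c + g' t / (2 * (g t * sqrt (g t)))"
      using low[OF t] pos[OF t] by (simp add: field_simps)
  qed
  then have "1 / sqrt (g t) \<le> 1 / sqrt (g 0) + c * t" by simp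
  then have "(1 / sqrt (g t))\<^sup>2 \<le> (1 / sqrt (g 0) + c * t)\<^sup>2"
    using pos[OF t] by (intro power_mono) auto
  then have *: "1 / g t \<le> (1 / sqrt (g 0) + c * t)\<^sup>2"
    using pos[OF t] by (simp add: power_divide)
  moreover have "0 < 1 / g t" using pos[OF t] by simp
  ultimately have "0 < (1 / sqrt (g 0) + c * t)\<^sup>2" by (rule less_le_trans[rotated])
  then show ?thesis using * pos[OF t] by (simp add: divide_simps mult.commute)
qed

section \<open>Predictions, their partial derivatives and the loss\<close>

text \<open>Passing from the Heisenberg to the Schrodinger picture moves the ansatz from the
  observable to the state vectors.\<close>

lemma loss_rotated_observable:
  assumes "\<And>j a b. j \<in> {1..m} \<Longrightarrow> \<rho> j $ a $ b = v j $ a * cnj (v j $ b)"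
  shows "loss m \<rho> y (rotated_observable M0 U H p \<theta>) = 1 / (2 * real m) *
    (\<Sum>j=1..m. (inner (ansatz U H p \<theta> *v v j) (M0 *v (ansatz U H p \<theta> *v v j)) - y j)\<^sup>2)"
proof -
  have "Re (trace (\<rho> j ** rotated_observable M0 U H p \<theta>))
      = inner (ansatz U H p \<theta> *v v j) (M0 *v (ansatz U H p \<theta> *v v j))" if "j \<in> {1..m}" for j
    by (subst trace_rank_one[OF assms[OF that]]) (simp only: rotated_observable_def inner_cmat_mult_left
        matrix_vector_mul_assoc matrix_mul_assoc)
  then show ?thesis by (simp add: loss_def)
qed

text \<open>The partial derivative of a prediction in coordinate \<open>k\<close>. The factor 2
  merges the two product-rule terms, which agree for Hermitian \<open>M0\<close>.\<close>

definition expectation_partial ::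
  "'d::finite cmat \<Rightarrow> (nat \<Rightarrow> 'd cmat) \<Rightarrow> (nat \<Rightarrow> 'd cmat) \<Rightarrow> nat \<Rightarrow> (nat \<Rightarrow> real)
    \<Rightarrow> complex ^ 'd \<Rightarrow> nat \<Rightarrow> real" where
  "expectation_partial M0 U H p \<theta> v k =
    2 * inner (ansatz U H p \<theta> *v (pulled_back_gen U H \<theta> k *v v)) (M0 *v (ansatz U H p \<theta> *v v))"

lemma has_real_derivative_expectation:
  assumes "\<And>l. l \<in> {0..p} \<Longrightarrow> unitary (U l)" "\<And>l. l \<in> {1..p} \<Longrightarrow> hermitian (H l)"
    and M0: "hermitian M0"
    and "\<And>k. k \<in> {1..p} \<Longrightarrow> ((\<lambda>s. \<theta> s k) has_real_derivative \<omega> k) (at t within S)"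
  shows "((\<lambda>s. inner (ansatz U H p (\<theta> s) *v v) (M0 *v (ansatz U H p (\<theta> s) *v v)))
    has_real_derivative (\<Sum>k=1..p. \<omega> k * expectation_partial M0 U H p (\<theta> t) v k)) (at t within S)"
proof -
  let ?V = "ansatz U H p (\<theta> t)"
  let ?Q = "pulled_back_gen U H (\<theta> t)"
  let ?d = "\<Sum>k=1..p. \<omega> k *\<^sub>R (?V *v (?Q k *v v))"
  have "bounded_linear (\<lambda>A. ?V *v (A *v v))"
    by (intro bounded_linear_compose[OF matrix_vector_mul_bounded_linear bounded_linear_cmat_mult_vec])
  then have lin: "linear (\<lambda>A. ?V *v (A *v v))" by (rule bounded_linear.linear)
  then have d: "(?V ** (\<Sum>k=1..p. \<omega> k *\<^sub>R ?Q k)) *v v = ?d"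
    by (simp add: linear_sum[OF lin] linear_scale[OF lin] flip: matrix_vector_mul_assoc)
  have V: "((\<lambda>s. ansatz U H p (\<theta> s) *v v) has_vector_derivative ?d) (at t within S)"
    unfolding d[symmetric]
    by (rule bounded_linear.has_vector_derivative[OF bounded_linear_cmat_mult_vec
          has_vector_derivative_ansatz]; rule assms; assumption)
  have "((\<lambda>s. inner (ansatz U H p (\<theta> s) *v v) (M0 *v (ansatz U H p (\<theta> s) *v v)))
    has_real_derivative (inner (?V *v v) (M0 *v ?d) + inner ?d (M0 *v (?V *v v)))) (at t within S)"
    unfolding has_real_derivative_iff_has_vector_derivative
    by (intro bounded_bilinear.has_vector_derivative[OF bounded_bilinear_inner] V
        bounded_linear.has_vector_derivative[OF matrix_vector_mul_bounded_linear])
  moreover have "inner (?V *v v) (M0 *v ?d) = inner ?d (M0 *v (?V *v v))"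
    using M0 by (subst inner_commute) (simp add: inner_cmat_mult_left hermitian_def)
  moreover have "2 * inner ?d (M0 *v (?V *v v))
      = (\<Sum>k=1..p. \<omega> k * expectation_partial M0 U H p (\<theta> t) v k)"
    by (simp add: inner_sum_left expectation_partial_def sum_distrib_left mult_ac)
  ultimately show ?thesis by simp
qed

text \<open>\<open>M0\<close> is a self-adjoint involution, hence an isometry, and Cauchy-Schwarz
  applies to two unit vectors.\<close>

lemma abs_expectation_le_1:
  assumes U: "unitary V" and M0: "hermitian M0" "\<And>c. is_eigenvalue M0 c \<Longrightarrow> c \<in> {1, -1}"
    and v: "norm v = 1"
  shows "\<bar>inner (V *v v) (M0 *v (V *v v))\<bar> \<le> 1"
proof -
  have V: "norm (V *v v) = 1" using U v by (simp add: norm_unitary)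
  have "inner (M0 *v x) y = inner x (M0 *v y)" for x y
    using M0(1) by (simp add: inner_cmat_mult_left hermitian_def)
  then have "norm (M0 *v (V *v v)) = 1"
    using hermitian_involution[OF M0] V by (simp add: norm_eq_1)
  then show ?thesis
    using Cauchy_Schwarz_ineq2[of "V *v v" "M0 *v (V *v v)"] V by simp
qed

text \<open>Since \<open>Q\<^sub>k\<close> is skew-Hermitian, the direction in which the state moves is orthogonal to
  the state, so only the component of \<open>M\<^sub>0 V v\<close> orthogonal to \<open>V v\<close> contributes.\<close>

lemma abs_expectation_partial_le:
  assumes U: "\<And>l. l \<in> {0..p} \<Longrightarrow> unitary (U l)" and H: "\<And>l. l \<in> {1..p} \<Longrightarrow> hermitian (H l)"
    and M0: "hermitian M0" "\<And>c. is_eigenvalue M0 c \<Longrightarrow> c \<in> {1, -1}"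
    and v: "norm v = 1" and k: "k \<in> {1..p}"
  shows "\<bar>expectation_partial M0 U H p \<theta> v k\<bar> \<le> 2 * op_norm (H k) *
    sqrt (1 - (inner (ansatz U H p \<theta> *v v) (M0 *v (ansatz U H p \<theta> *v v)))\<^sup>2)"
proof -
  let ?V = "ansatz U H p \<theta>"
  let ?Q = "pulled_back_gen U H \<theta> k"
  have V: "unitary ?V" by (rule unitary_ansatz[OF U H])
  have "inner (?V *v (?Q *v v)) (?V *v v) = inner (?Q *v v) v"
    by (rule inner_unitary[OF V])
  \<comment> \<open>The complex form is in general only purely imaginary here; orthogonality in the
    real inner product is what the estimate needs.\<close>
  moreover have "inner (?Q *v v) v = 0"
  proof -
    have "(- ?Q) *v v = - (?Q *v v)"
      by (rule linear_neg[OF bounded_linear.linear[OF bounded_linear_cmat_mult_vec]])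
    then have "inner (?Q *v v) v = - inner (?Q *v v) v"
      using dagger_pulled_back_gen[where k = k and H = H and U = U and \<theta> = \<theta>] H[OF k]
      by (subst inner_cmat_mult_left) (simp add: inner_commute)
    then show ?thesis by simp
  qed
  ultimately have orth: "inner (?V *v (?Q *v v)) (?V *v v) = 0" by simp
  have sa: "inner (M0 *v x) y = inner x (M0 *v y)" for x y
    using M0(1) by (simp add: inner_cmat_mult_left hermitian_def)
  have "norm (?V *v v) = 1" using V v by (simp add: norm_unitary)
  from abs_inner_involution_le[of "(*v) M0", OF sa hermitian_involution[OF M0] this orth]
  have "\<bar>inner (?V *v (?Q *v v)) (M0 *v (?V *v v))\<bar> \<le> norm (?Q *v v) *
      sqrt (1 - (inner (?V *v v) (M0 *v (?V *v v)))\<^sup>2)"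
    using V by (simp add: norm_unitary)
  moreover have "norm (?Q *v v) \<le> op_norm (H k)"
    using norm_pulled_back_gen_mult[where v = v and U = U and H = H, OF U H k] v by simp
  moreover have "(inner (?V *v v) (M0 *v (?V *v v)))\<^sup>2 \<le> 1"
    using abs_expectation_le_1[OF V M0 v] by (simp add: abs_square_le_1)
  ultimately show ?thesis
    by (simp add: expectation_partial_def abs_mult)
      (meson mult_right_mono order_trans real_sqrt_ge_zero diff_ge_0_iff_ge)
qed

section \<open>The bound on a partial derivative of the loss\<close>

text \<open>For a fixed coordinate, \<open>f j\<close> stands for the predictions,
  \<open>D j\<close> for their partial derivatives and \<open>h\<close> for the norm of the
  generator; the squared term is then the partial derivative of the loss.\<close>

lemma loss_gradient_bound:
  fixes f y D :: "nat \<Rightarrow> real"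
  assumes m: "m \<ge> 1" and y: "\<And>j. j \<in> {1..m} \<Longrightarrow> y j \<in> {1, -1}"
    and f: "\<And>j. j \<in> {1..m} \<Longrightarrow> \<bar>f j\<bar> \<le> 1" and h: "h \<ge> 0"
    and D: "\<And>j. j \<in> {1..m} \<Longrightarrow> \<bar>D j\<bar> \<le> 2 * h * sqrt (1 - (f j)\<^sup>2)"
    and L: "L = 1 / (2 * real m) * (\<Sum>j=1..m. (f j - y j)\<^sup>2)"
  shows "(1 / real m * (\<Sum>j=1..m. (f j - y j) * D j))\<^sup>2 \<le> 24 * h\<^sup>2 * (L * sqrt L)"
proof -
  define e where "e j = \<bar>f j - y j\<bar>" for j
  let ?S = "\<Sum>j=1..m. (e j)\<^sup>2"
  have m0: "real m > 0" using m by simp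
  have S: "?S = 2 * real m * L" using m0 by (simp add: L e_def)
  have L0: "L \<ge> 0" unfolding L by (intro mult_nonneg_nonneg sum_nonneg) auto
  have De: "\<bar>D j\<bar> \<le> 2 * h * sqrt (2 * e j)" if j: "j \<in> {1..m}" for j
  proof -
    \<comment> \<open>Of the factors \<open>1 - f j\<close> and \<open>1 + f j\<close>, the label
      \<open>y j\<close> selects one equal to \<open>e j\<close>; the other is at most 2.\<close>
    have "1 - (f j)\<^sup>2 \<le> 2 * e j"
    proof -
      have "(1 - f j) * (1 + f j) \<le> (1 - f j) * 2" "(1 - f j) * (1 + f j) \<le> 2 * (1 + f j)"
        by (intro mult_left_mono mult_right_mono; use f[OF j] in simp)+
      then show ?thesis using y[OF j] f[OF j] by (auto simp: e_def power2_eq_square algebra_simps)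
    qed
    then have "2 * h * sqrt (1 - (f j)\<^sup>2) \<le> 2 * h * sqrt (2 * e j)"
      using h by (intro mult_left_mono) auto
    with D[OF j] show ?thesis by linarith
  qed
  have "\<bar>\<Sum>j=1..m. (f j - y j) * D j\<bar> \<le> (\<Sum>j=1..m. \<bar>(f j - y j) * D j\<bar>)" by (rule sum_abs)
  also have "\<dots> \<le> (\<Sum>j=1..m. e j * (2 * h * sqrt (2 * e j)))"
    unfolding abs_mult e_def[symmetric]
    by (intro sum_mono mult_left_mono De) (auto simp: e_def)
  also have "\<dots> = 2 * h * sqrt 2 * (\<Sum>j=1..m. sqrt (e j) * e j)"
    by (simp add: real_sqrt_mult sum_distrib_left mult_ac)
  finally have "\<bar>\<Sum>j=1..m. (f j - y j) * D j\<bar>\<^sup>2 \<le> (2 * h * sqrt 2 * (\<Sum>j=1..m. sqrt (e j) * e j))\<^sup>2"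
    by (rule power_mono) simp
  then have 1: "(\<Sum>j=1..m. (f j - y j) * D j)\<^sup>2 \<le> 8 * h\<^sup>2 * (\<Sum>j=1..m. sqrt (e j) * e j)\<^sup>2"
    by (simp add: power_mult_distrib mult_ac)
  \<comment> \<open>The first Cauchy-Schwarz pairs \<open>sqrt (e j)\<close> with
    \<open>e j\<close>; the second pairs \<open>e j\<close> with the constant 1, so that only
    \<open>?S\<close> remains.\<close>
  have "(\<Sum>j=1..m. sqrt (e j) * e j)\<^sup>2 \<le> (\<Sum>j=1..m. (sqrt (e j))\<^sup>2) * ?S"
    by (rule Cauchy_Schwarz_ineq_sum)
  also have "(\<Sum>j=1..m. (sqrt (e j))\<^sup>2) = (\<Sum>j=1..m. e j)"
    by (intro sum.cong) (auto simp: e_def)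
  also have "(\<Sum>j=1..m. e j) \<le> real m * sqrt (2 * L)"
  proof (rule power2_le_imp_le)
    have "(\<Sum>j=1..m. e j)\<^sup>2 \<le> (\<Sum>j=1..m. 1\<^sup>2) * ?S"
      using Cauchy_Schwarz_ineq_sum[of "\<lambda>j. 1" e "{1..m}"] by simp
    also have "\<dots> = (real m * sqrt (2 * L))\<^sup>2"
      using L0 by (simp only: S) (simp add: power_mult_distrib power2_eq_square)
    finally show "(\<Sum>j=1..m. e j)\<^sup>2 \<le> (real m * sqrt (2 * L))\<^sup>2" .
  qed (use L0 in simp)
  finally have 2: "(\<Sum>j=1..m. sqrt (e j) * e j)\<^sup>2 \<le> real m * sqrt (2 * L) * ?S"
    by (simp add: mult_right_mono sum_nonneg)
  have "(1 / real m * (\<Sum>j=1..m. (f j - y j) * D j))\<^sup>2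
      = (1 / (real m)\<^sup>2) * (\<Sum>j=1..m. (f j - y j) * D j)\<^sup>2"
    by (simp add: power_mult_distrib power_divide)
  also have "\<dots> \<le> (1 / (real m)\<^sup>2) * (8 * h\<^sup>2 * (real m * sqrt (2 * L) * ?S))"
    by (intro mult_left_mono order_trans[OF 1] 2) auto
  also have "\<dots> = 16 * sqrt 2 * (h\<^sup>2 * (L * sqrt L))"
    using m0 unfolding S by (simp add: real_sqrt_mult field_simps power2_eq_square)
  \<comment> \<open>Rounding up to 24, twice the 12 in the rate \<open>c1\<close>.\<close>
  also have "\<dots> \<le> 24 * (h\<^sup>2 * (L * sqrt L))"
  proof (rule mult_right_mono)
    have "sqrt 2 \<le> 3 / 2" by (rule real_le_lsqrt) (auto simp: power2_eq_square)
    then show "16 * sqrt 2 \<le> 24" by simp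
  qed (use L0 in auto)
  finally show ?thesis by simp
qed

section \<open>Decay of the loss along the gradient flow\<close>

theorem theorem3p2:
  fixes \<rho> :: "nat \<Rightarrow> complex ^ 'd::finite ^ 'd"
    and y :: "nat \<Rightarrow> real"
    and M0 :: "complex ^ 'd ^ 'd"
    and U H :: "nat \<Rightarrow> complex ^ 'd ^ 'd"
    and p m :: nat
    and \<eta> :: real
    and \<theta> :: "real \<Rightarrow> nat \<Rightarrow> real"
    and L :: "(nat \<Rightarrow> real) \<Rightarrow> real"
    and c0 c1 :: real
  assumes "p \<ge> 1" and "m \<ge> 1"
    and "\<And>j. j \<in> {1..m} \<Longrightarrow> pure_state (\<rho> j)"
    and "\<And>j. j \<in> {1..m} \<Longrightarrow> y j \<in> {1, -1}"
    and "hermitian M0" and "\<And>c. is_eigenvalue M0 c \<Longrightarrow> c \<in> {1, -1}"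
    and "\<And>l. l \<in> {0..p} \<Longrightarrow> unitary (U l)"
    and "\<And>l. l \<in> {1..p} \<Longrightarrow> hermitian (H l) \<and> trace (H l) = 0 \<and> H l \<noteq> 0"
    and "L = (\<lambda>x. loss m \<rho> y (rotated_observable M0 U H p x))"
    and "\<eta> > 0"
    and "gradient_flow p \<eta> L \<theta>"
    and "L (\<theta> 0) > 0"
    and "c0 = 1 / sqrt (L (\<theta> 0))"
    and "c1 = 12 * \<eta> * (\<Sum>l=1..p. (op_norm (H l))\<^sup>2)"
  shows "\<forall>t\<ge>0. L (\<theta> t) \<ge> 1 / (c0 + c1 * t)\<^sup>2"
proof -
  note m = \<open>m \<ge> 1\<close> and M0 = assms(5,6) and U = assms(7)
  have H: "hermitian (H l)" if "l \<in> {1..p}" for l using assms(8)[OF that] by simp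
  have "\<forall>j\<in>{1..m}. \<exists>v. norm v = 1 \<and> (\<forall>a b. \<rho> j $ a $ b = v $ a * cnj (v $ b))"
    using pure_state_rank_one[OF assms(3)] by metis
  then obtain v where v: "\<And>j. j \<in> {1..m} \<Longrightarrow> norm (v j) = 1"
    and \<rho>: "\<And>j a b. j \<in> {1..m} \<Longrightarrow> \<rho> j $ a $ b = v j $ a * cnj (v j $ b)"
    by metis
  define f where "f x j = inner (ansatz U H p x *v v j) (M0 *v (ansatz U H p x *v v j))" for x j
  define D where "D x j k = expectation_partial M0 U H p x (v j) k" for x j k
  define G where "G x k = 1 / real m * (\<Sum>j=1..m. (f x j - y j) * D x j k)" for x k
  have L: "L x = 1 / (2 * real m) * (\<Sum>j=1..m. (f x j - y j)\<^sup>2)" for x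
    using loss_rotated_observable[OF \<rho>] by (simp add: \<open>L = _\<close> f_def)
  \<comment> \<open>The chain rule for an arbitrary curve is used twice: on coordinate lines it
    identifies \<open>G\<close> with the partial derivatives, and on the flow it gives the time
    derivative of the loss.\<close>
  have L_deriv: "((\<lambda>s. L (\<phi> s)) has_real_derivative (\<Sum>k=1..p. \<omega> k * G (\<phi> t) k)) (at t within S)"
    if "\<And>k. k \<in> {1..p} \<Longrightarrow> ((\<lambda>s. \<phi> s k) has_real_derivative \<omega> k) (at t within S)" for \<phi> \<omega> t S
  proof -
    have halve: "1 / (2 * real m) * (2 * a * b) = 1 / real m * (a * b)" for a b :: real
      by simp
    have "((\<lambda>s. f (\<phi> s) j) has_real_derivative (\<Sum>k=1..p. \<omega> k * D (\<phi> t) j k)) (at t within S)" for j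
      unfolding f_def D_def by (rule has_real_derivative_expectation[OF U H M0(1) that])
    then have "((\<lambda>s. L (\<phi> s)) has_real_derivative 1 / (2 * real m) *
        (\<Sum>j=1..m. 2 * (f (\<phi> t) j - y j) * (\<Sum>k=1..p. \<omega> k * D (\<phi> t) j k))) (at t within S)"
      unfolding L using m by (auto intro!: derivative_eq_intros DERIV_cmult sum.cong)
    also have "1 / (2 * real m) * (\<Sum>j=1..m. 2 * (f (\<phi> t) j - y j) * (\<Sum>k=1..p. \<omega> k * D (\<phi> t) j k))
        = (\<Sum>j=1..m. \<Sum>k=1..p. \<omega> k * (1 / real m * ((f (\<phi> t) j - y j) * D (\<phi> t) j k)))"
      by (subst sum_distrib_left, simp only: halve) (simp add: sum_distrib_left mult_ac)
    also have "\<dots> = (\<Sum>k=1..p. \<omega> k * G (\<phi> t) k)"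
      unfolding G_def by (subst sum.swap) (simp add: sum_distrib_left)
    finally show ?thesis .
  qed
  have partial: "partial_deriv l L x = G x l" if l: "l \<in> {1..p}" for l x
  proof -
    \<comment> \<open>Since \<open>deriv\<close> is meaningful only where a derivative exists,
      differentiability along the coordinate line is proved before its value is read off.\<close>
    have "((\<lambda>s. (x(l := s)) k) has_real_derivative of_bool (k = l)) (at (x l))" for k
      by (cases "k = l") (auto intro!: derivative_eq_intros)
    from L_deriv[of "\<lambda>s. x(l := s)" "\<lambda>k. of_bool (k = l)" "x l" UNIV, OF this]
    have "((\<lambda>s. L (x(l := s))) has_real_derivative (\<Sum>k=1..p. of_bool (k = l) * G x k)) (at (x l))"
      by (simp only: fun_upd_triv)
    also have "(\<Sum>k=1..p. of_bool (k = l) * G x k) = G x l"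
      using l by (simp add: of_bool_def if_distrib[of "\<lambda>c. c * _"] cong: if_cong)
    finally show ?thesis unfolding partial_deriv_def by (rule DERIV_imp_deriv)
  qed
  have grad: "(G x k)\<^sup>2 \<le> 24 * (op_norm (H k))\<^sup>2 * (L x * sqrt (L x))" if k: "k \<in> {1..p}" for x k
    unfolding G_def
  proof (rule loss_gradient_bound[OF m assms(4) _ op_norm_nonneg _ L])
    fix j assume j: "j \<in> {1..m}"
    show "\<bar>f x j\<bar> \<le> 1"
      unfolding f_def by (rule abs_expectation_le_1[OF unitary_ansatz[OF U H] M0 v[OF j]])
    show "\<bar>D x j k\<bar> \<le> 2 * op_norm (H k) * sqrt (1 - (f x j)\<^sup>2)"
      unfolding f_def D_def by (rule abs_expectation_partial_le[OF U H M0 v[OF j] k])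
  qed
  have L0: "L x \<ge> 0" for x
    unfolding L by (intro mult_nonneg_nonneg sum_nonneg) auto
  show ?thesis
  proof (intro allI impI)
    fix t :: real assume "t \<ge> 0"
    show "L (\<theta> t) \<ge> 1 / (c0 + c1 * t)\<^sup>2"
      unfolding \<open>c0 = _\<close>
    proof (rule sublinear_decay[where g = "\<lambda>s. L (\<theta> s)" and c = c1
          and g' = "\<lambda>s. - \<eta> * (\<Sum>k=1..p. (G (\<theta> s) k)\<^sup>2)",
          OF _ L0 _ _ \<open>L (\<theta> 0) > 0\<close> _ \<open>t \<ge> 0\<close>])
      show "0 \<le> c1" using \<open>\<eta> > 0\<close> by (simp add: \<open>c1 = _\<close> sum_nonneg)
      fix s :: real assume s: "s \<ge> 0"
      have "((\<lambda>s. \<theta> s k) has_real_derivative - \<eta> * G (\<theta> s) k) (at s within {0..})"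
        if "k \<in> {1..p}" for k
        using \<open>gradient_flow p \<eta> L \<theta>\<close> s that partial[OF that] unfolding gradient_flow_def by metis
      \<comment> \<open>With velocity \<open>- \<eta> * G\<close>, the chain rule yields
        \<open>- \<eta>\<close> times the squared gradient norm.\<close>
      from L_deriv[of \<theta> "\<lambda>k. - \<eta> * G (\<theta> s) k", OF this]
      show "((\<lambda>s. L (\<theta> s)) has_real_derivative - \<eta> * (\<Sum>k=1..p. (G (\<theta> s) k)\<^sup>2)) (at s within {0..})"
        by (simp add: sum_distrib_left power2_eq_square mult_ac sum_negf)
      show "- \<eta> * (\<Sum>k=1..p. (G (\<theta> s) k)\<^sup>2) \<le> 0"
        using \<open>\<eta> > 0\<close> by (simp add: sum_nonneg)
      have "\<eta> * (\<Sum>k=1..p. (G (\<theta> s) k)\<^sup>2)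
          \<le> \<eta> * (\<Sum>k=1..p. 24 * (op_norm (H k))\<^sup>2 * (L (\<theta> s) * sqrt (L (\<theta> s))))"
        using \<open>\<eta> > 0\<close> by (intro mult_left_mono sum_mono grad) auto
      also have "\<dots> = 2 * c1 * (L (\<theta> s) * sqrt (L (\<theta> s)))"
        by (simp add: \<open>c1 = _\<close> sum_distrib_left sum_distrib_right mult_ac)
      finally show "- (2 * c1 * (L (\<theta> s) * sqrt (L (\<theta> s)))) \<le> - \<eta> * (\<Sum>k=1..p. (G (\<theta> s) k)\<^sup>2)"
        by simp
    qed
  qed
qed

end
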